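(* For any integer $b \ge 2$ we have $$\liminf_{n \to +\infty} \frac{p(n,\mathrm{e},b)}{n} \ge \frac{9}{8} \quad\text{and}\quad \limsup_{n \to +\infty} \frac{p(n,\mathrm{e},b)}{n} \ge \frac{8}{7},$$ where $\mathrm{e}$ is the base of the natural logarithm.
   Context: The $b$-ary expansion of a real number $\xi$ is the unique infinite sequence $(a_j)_{j\ge 1}$ of integers from $\{0,1,\ldots,b-1\}$ such that $\xi = \lfloor \xi \rfloor + \sum_{j\ge 1} a_j/b^j$ and $a_j \ne b-1$ for infinitely many indices $j$. For $n \ge 1$, $p(n,\xi,b)$ is the number of distinct blocks of length $n$ in this expansion: $p(n,\xi,b) = \#\{a_{j+1}a_{j+2}\cdots a_{j+n} : j \ge 0\}$. *)

theory Defs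
  imports "HOL-Analysis.Analysis"
begin

text \<open>
  Sequences are indexed from 0: the value \<open>a i\<close> is the digit \<open>a\<^sub>j\<close>
  with \<open>j = i + 1\<close> of the expansion \<open>\<xi> = \<lfloor>\<xi>\<rfloor> + \<Sum>\<^sub>j\<^sub>\<ge>\<^sub>1 a\<^sub>j / b\<^sup>j\<close>.
\<close>

definition is_expansion :: "nat \<Rightarrow> real \<Rightarrow> (nat \<Rightarrow> nat) \<Rightarrow> bool" where
  "is_expansion b \<xi> a \<longleftrightarrow>
     (\<forall>i. a i \<in> {0..b - 1}) \<and>
     (\<lambda>i. real (a i) / real b ^ (i + 1)) sums (\<xi> - of_int \<lfloor>\<xi>\<rfloor>) \<and>
     infinite {i. a i \<noteq> b - 1}"

definition digits :: "nat \<Rightarrow> real \<Rightarrow> nat \<Rightarrow> nat" where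
  "digits b \<xi> = (THE a. is_expansion b \<xi> a)"

definition block :: "(nat \<Rightarrow> 'a) \<Rightarrow> nat \<Rightarrow> nat \<Rightarrow> 'a list" where
  "block a j n = map (\<lambda>i. a (j + i)) [0..<n]"

definition complexity :: "nat \<Rightarrow> real \<Rightarrow> nat \<Rightarrow> nat" where
  "complexity n \<xi> b = card {block (digits b \<xi>) j n | j. True}"

lemma geometric_tail_sums:
  assumes "b \<ge> 2"
  shows "(\<lambda>i. real (b - 1) / real b ^ (i + n + 1)) sums (1 / real b ^ n)"
proof -
  define B where "B = real b"
  have B: "B > 1" using assms by (simp add: B_def)
  have "(\<lambda>i. (B - 1) / B ^ (n + 1) * (1 / B) ^ i) sums ((B - 1) / B ^ (n + 1) * (1 / (1 - 1 / B)))"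
    using B by (intro sums_mult geometric_sums) auto
  moreover have "1 / (1 - 1 / B) = B / (B - 1)"
    using B by (simp add: divide_simps)
  moreover have "(B - 1) / B ^ (n + 1) * (B / (B - 1)) = 1 / B ^ n"
    using B by simp
  moreover have "(B - 1) / B ^ (n + 1) * (1 / B) ^ i = (B - 1) / B ^ (i + n + 1)" for i
    by (simp add: power_add power_one_over mult_ac)
  moreover have "real (b - 1) = B - 1" using assms by (simp add: B_def of_nat_diff)
  ultimately show ?thesis by (simp only: B_def)
qed

lemma expansion_partial_sum:
  assumes b: "b \<ge> 2" and a: "is_expansion b \<xi> a"
  shows "(\<Sum>i<n. real (a i) / real b ^ (i + 1)) = of_int \<lfloor>real b ^ n * frac \<xi>\<rfloor> / real b ^ n"
proof -
  define S where "S = (\<Sum>i<n. real (a i) / real b ^ (i + 1))"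
  have dig: "a i \<le> b - 1" for i using a by (auto simp: is_expansion_def)
  have "(\<lambda>i. real (a i) / real b ^ (i + 1)) sums frac \<xi>"
    using a by (simp add: is_expansion_def frac_def)
  hence tail: "(\<lambda>i. real (a (i + n)) / real b ^ (i + n + 1)) sums (frac \<xi> - S)"
    unfolding S_def by (rule sums_split_initial_segment)
  have ge: "0 \<le> frac \<xi> - S"
    by (rule sums_le[OF _ sums_zero tail]) auto
  have "infinite {i. a i \<noteq> b - 1}" using a by (simp add: is_expansion_def)
  then obtain k where k: "k \<ge> n" "a k \<noteq> b - 1"
    unfolding infinite_nat_iff_unbounded_le by auto
  let ?d = "\<lambda>i. real (b - 1) / real b ^ (i + n + 1) - real (a (i + n)) / real b ^ (i + n + 1)"
  have d: "?d sums (1 / real b ^ n - (frac \<xi> - S))"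
    by (intro sums_diff geometric_tail_sums b tail)
  have "0 < suminf ?d"
  proof (rule suminf_pos2)
    show "summable ?d" using d by (rule sums_summable)
    show "0 \<le> ?d i" for i
      using dig[of "i + n"] by (simp add: divide_right_mono)
    have "a k < b - 1" using k dig[of k] by simp
    thus "0 < ?d (k - n)"
      using k b by (simp add: divide_strict_right_mono)
  qed
  hence lt: "frac \<xi> - S < 1 / real b ^ n"
    using d by (simp add: sums_iff)
  define N where "N = (\<Sum>i<n. int (a i) * int b ^ (n - (i + 1)))"
  have N: "real b ^ n * S = of_int N"
    unfolding S_def N_def sum_distrib_left of_int_sum
  proof (rule sum.cong[OF refl])
    fix i assume "i \<in> {..<n}"
    hence "real b ^ n = real b ^ (i + 1) * real b ^ (n - (i + 1))"
      by (subst power_add [symmetric]) simp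
    thus "real b ^ n * (real (a i) / real b ^ (i + 1)) =
        real_of_int (int (a i) * int b ^ (n - (i + 1)))"
      using b by simp
  qed
  have pos: "real b ^ n > 0" using b by simp
  have "of_int N \<le> real b ^ n * frac \<xi>"
    unfolding N[symmetric] using ge pos by (intro mult_left_mono) auto
  moreover have "real b ^ n * (frac \<xi> - S) < real b ^ n * (1 / real b ^ n)"
    using lt pos by (rule mult_strict_left_mono)
  hence "real b ^ n * frac \<xi> < of_int N + 1"
    using b N by (simp add: right_diff_distrib)
  ultimately have "\<lfloor>real b ^ n * frac \<xi>\<rfloor> = N" by (simp add: floor_eq_iff)
  thus ?thesis using N b unfolding S_def[symmetric] by (simp add: eq_divide_eq mult.commute)
qed

lemma expansion_unique:
  assumes b: "b \<ge> 2" and a: "is_expansion b \<xi> a" and a': "is_expansion b \<xi> a'"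
  shows "a = a'"
proof
  fix i
  have *: "(\<Sum>i<n. real (a i) / real b ^ (i + 1)) = (\<Sum>i<n. real (a' i) / real b ^ (i + 1))" for n
    using expansion_partial_sum[OF b a] expansion_partial_sum[OF b a'] by simp
  from *[of "Suc i"] *[of i] have "real (a i) / real b ^ (i + 1) = real (a' i) / real b ^ (i + 1)"
    by simp
  thus "a i = a' i" using b by simp
qed

lemma expansion_exists:
  assumes b: "b \<ge> 2"
  shows "\<exists>a. is_expansion b \<xi> a"
proof -
  define F where "F n = \<lfloor>real b ^ n * frac \<xi>\<rfloor>" for n
  define a where "a i = nat (F (Suc i) - int b * F i)" for i
  have F0: "F 0 = 0" by (simp add: F_def floor_eq_iff frac_lt_1)
  have Fb: "of_int (F n) \<le> real b ^ n * frac \<xi>" "real b ^ n * frac \<xi> < of_int (F n) + 1" for n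
    unfolding F_def by linarith+
  have bnd: "0 \<le> F (Suc i) - int b * F i \<and> F (Suc i) - int b * F i < int b" for i
  proof
    have "real b * of_int (F i) \<le> real b * (real b ^ i * frac \<xi>)"
      using Fb by (intro mult_left_mono) auto
    also have "\<dots> < of_int (F (Suc i)) + 1" using Fb(2)[of "Suc i"] by (simp add: mult.assoc)
    finally have "real_of_int (int b * F i) < real_of_int (F (Suc i) + 1)" by simp
    hence "int b * F i < F (Suc i) + 1" by (simp only: of_int_less_iff)
    thus "0 \<le> F (Suc i) - int b * F i" by simp
    have "of_int (F (Suc i)) \<le> real b * (real b ^ i * frac \<xi>)"
      using Fb(1)[of "Suc i"] by (simp add: mult.assoc)
    also have "\<dots> < real b * (of_int (F i) + 1)"
      using Fb b by (intro mult_strict_left_mono) auto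
    finally have "real_of_int (F (Suc i)) < real_of_int (int b * (F i + 1))" by simp
    hence "F (Suc i) < int b * (F i + 1)" by (simp only: of_int_less_iff)
    thus "F (Suc i) - int b * F i < int b" by (simp add: algebra_simps)
  qed
  have ra: "real (a i) = of_int (F (Suc i)) - real b * of_int (F i)" for i
    using bnd[of i] by (simp add: a_def)
  have part: "(\<Sum>i<n. real (a i) / real b ^ (i + 1)) = of_int (F n) / real b ^ n" for n
  proof (induction n)
    case (Suc n)
    have "of_int (F n) / real b ^ n = real b * of_int (F n) / real b ^ (n + 1)"
      using b by simp
    thus ?case using Suc by (simp add: ra diff_divide_distrib)
  qed (simp add: F0)
  have lim: "(\<lambda>n. of_int (F n) / real b ^ n) \<longlonglongrightarrow> frac \<xi>"
  proof (rule tendsto_sandwich)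
    have "(\<lambda>n. (1 / real b) ^ n) \<longlonglongrightarrow> 0" using b by (intro LIMSEQ_power_zero) auto
    from tendsto_diff[OF tendsto_const[of "frac \<xi>"] this]
    show "(\<lambda>n. frac \<xi> - (1 / real b) ^ n) \<longlonglongrightarrow> frac \<xi>" by simp
    show "(\<lambda>n. frac \<xi>) \<longlonglongrightarrow> frac \<xi>" by simp
    show "eventually (\<lambda>n. frac \<xi> - (1 / real b) ^ n \<le> of_int (F n) / real b ^ n) sequentially"
    proof (rule always_eventually, rule allI)
      fix n show "frac \<xi> - (1 / real b) ^ n \<le> of_int (F n) / real b ^ n"
      proof -
        have "frac \<xi> \<le> (of_int (F n) + 1) / real b ^ n"
          using Fb(2)[of n] b by (simp add: pos_le_divide_eq mult.commute)
        thus ?thesis by (simp add: add_divide_distrib power_one_over)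
      qed
    qed
    show "eventually (\<lambda>n. of_int (F n) / real b ^ n \<le> frac \<xi>) sequentially"
    proof (rule always_eventually, rule allI)
      fix n show "of_int (F n) / real b ^ n \<le> frac \<xi>"
        using Fb(1)[of n] b by (simp add: pos_divide_le_eq mult.commute)
    qed
  qed
  have sums: "(\<lambda>i. real (a i) / real b ^ (i + 1)) sums frac \<xi>"
    unfolding sums_def part by (rule lim)
  have inf: "infinite {i. a i \<noteq> b - 1}"
  proof
    assume "finite {i. a i \<noteq> b - 1}"
    then obtain n where "\<forall>i\<in>{i. a i \<noteq> b - 1}. i < n"
      by (auto simp only: finite_nat_set_iff_bounded)
    hence n: "a i = b - 1" if "i \<ge> n" for i
      using that by (meson leD mem_Collect_eq)
    have "(\<lambda>i. real (a (i + n)) / real b ^ (i + n + 1)) sums (frac \<xi> - of_int (F n) / real b ^ n)"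
      using sums_split_initial_segment[OF sums, of n] unfolding part .
    moreover have "(\<lambda>i. real (a (i + n)) / real b ^ (i + n + 1)) sums (1 / real b ^ n)"
      using geometric_tail_sums[OF b, of n] by (simp add: n)
    ultimately have "frac \<xi> - of_int (F n) / real b ^ n = 1 / real b ^ n"
      by (rule sums_unique2)
    hence "real b ^ n * frac \<xi> = of_int (F n) + 1"
    proof -
      assume "frac \<xi> - of_int (F n) / real b ^ n = 1 / real b ^ n"
      hence "frac \<xi> = (of_int (F n) + 1) / real b ^ n"
        unfolding add_divide_distrib by linarith
      thus ?thesis using b by simp
    qed
    thus False using Fb(2)[of n] by simp
  qed
  have "a i \<in> {0..b - 1}" for i using bnd[of i] by (auto simp: a_def)
  hence "is_expansion b \<xi> a"
    using sums inf by (simp only: is_expansion_def frac_def) simp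
  thus ?thesis by (rule exI[of _ a])
qed

lemma is_expansion_digits:
  assumes "b \<ge> 2"
  shows "is_expansion b \<xi> (digits b \<xi>)"
proof -
  have "\<exists>!a. is_expansion b \<xi> a"
    using expansion_exists[OF assms, of \<xi>] expansion_unique[OF assms, of \<xi>] by metis
  thus ?thesis unfolding digits_def by (rule theI'[of "is_expansion b \<xi>"])
qed

end

theory Submission
  imports Defs "HOL-Real_Asymp.Real_Asymp"
begin

text \<open>
  Two facts meet here: \<open>e\<close> has no rational approximations much better than those every
  irrational number has, and a word with few blocks repeats some block early, which
  produces good rational approximations.

  A block of length \<open>n\<close> that occurs at positions \<open>i < j\<close> of the \<open>b\<close>-ary expansion puts
  \<open>(b\<^sup>j - b\<^sup>i) \<sqdot> e\<close> within \<open>b\<^sup>-\<^sup>n\<close> of an integer. The denominators are at most \<open>b\<^sup>j\<close>, and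
  \<open>\<bar>q e - p\<bar>\<close> is at least a constant times \<open>1 / (q (1 + ln q))\<close>
  (\<open>e_irrationality_measure\<close>), so \<open>n \<le> j + o(j)\<close> (\<open>repeats_digits_e\<close>). The bound for
  \<open>\<bar>q e - p\<bar>\<close> comes from the continued fraction of \<open>(e + 1) / (e - 1)\<close>, whose partial quotients grow
  only linearly.

  For a word with \<open>p(n)\<close> blocks of length \<open>n\<close>, let \<open>j(n)\<close> be the first position whose block
  of length \<open>n\<close> has occurred before. The blocks at \<open>0, \<dots>, j(n) - 1\<close> are distinct, so
  \<open>p(n) \<ge> j(n)\<close>. This alone only gives \<open>p(n) \<ge> n - o(n)\<close>. The gain comes from following the
  jumps of the step function \<open>j\<close> downwards from a given length \<open>n\<close>. Write
  \<open>p(n) = n + f\<close>; as \<open>p\<close> is strictly increasing, \<open>p(m) \<le> m + f\<close> for all \<open>m \<le> n\<close>, hence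
  consecutive jump lengths, and consecutive values of \<open>j\<close>, differ by at most
  \<open>f + o(n)\<close>. Call a first repeat early if the earlier of its two occurrences starts at a position
  at most \<open>f\<close>.

  \<^item> Of two consecutive first repeats, at least one is early. Otherwise the stretches on
    which they are periodic overlap enough to force the shorter repeat to be longer
    (\<open>repeats_overlap\<close>, an instance of the Fine--Wilf phenomenon).

  \<^item> If two first repeats \<open>(i, j)\<close> of maximal length \<open>m\<close> and \<open>(i', j')\<close> with \<open>j < j'\<close> are both
    early, then \<open>m \<le> 2 (j' - j) + f + o(n)\<close>. Their periods are then almost equal, and
    the difference of the periods is itself the period of a repeat which would be too long
    (\<open>repeats_compare\<close>).

  Thus, if the repeat for \<open>n\<close> is early, then the next or the second next one below it is early
  too, with \<open>m \<ge> n - 2 f - o(n)\<close> and \<open>j' - j \<le> 2 f + o(n)\<close>, which forces \<open>n \<le> 7 f + o(n)\<close>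
  (\<open>first_repeat_early_imp_excess\<close>). If it is not early, the one below it is, and one more
  step down gives \<open>n \<le> 8 f + o(n)\<close>. Hence \<open>p(n) \<ge> (9/8) n - o(n)\<close> for all \<open>n\<close>, and
  \<open>p(n) \<ge> (8/7) n - o(n)\<close> for infinitely many \<open>n\<close>, because early repeats occur at least at
  every second jump.
\<close>

section \<open>Rational approximations to e\<close>

text \<open>
  With \<open>z = 1/2\<close>, the coefficients of the functions in the continued fraction of the
  hyperbolic cotangent: the series for \<open>n = 0\<close> and \<open>n = 1\<close> are \<open>cosh z\<close> and \<open>sinh z\<close>, and each
  pair of consecutive series is linked by a three-term recurrence.
\<close>

definition coth_coeff :: "nat \<Rightarrow> nat \<Rightarrow> real" where
  "coth_coeff n k = fact (n + k) / (fact k * fact (2 * (n + k)) * 4 ^ k)"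

definition coth_series :: "nat \<Rightarrow> real" where
  "coth_series n = (\<Sum>k. coth_coeff n k)"

lemma coth_coeff_pos: "coth_coeff n k > 0"
  by (simp add: coth_coeff_def)

lemma summable_coth_coeff: "summable (coth_coeff n)"
proof (rule summable_comparison_test')
  show "summable (\<lambda>k. (1 / 4 :: real) ^ k)" by (rule summable_geometric) simp
  fix k
  have "(fact (n + k) :: real) \<le> fact (2 * (n + k))" by (rule fact_mono) simp
  also have "\<dots> \<le> fact k * fact (2 * (n + k))"
    using fact_ge_1[of k, where 'a = real] by simp
  finally have "fact (n + k) / (fact k * fact (2 * (n + k))) \<le> (1 :: real)" by simp
  hence "fact (n + k) / (fact k * fact (2 * (n + k))) / 4 ^ k \<le> (1 :: real) / 4 ^ k"
    by (rule divide_right_mono) simp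
  thus "norm (coth_coeff n k) \<le> (1 / 4) ^ k"
    using coth_coeff_pos[of n k] by (simp add: coth_coeff_def power_one_over)
qed

lemma coth_series_pos: "coth_series n > 0"
  unfolding coth_series_def by (rule suminf_pos[OF summable_coth_coeff coth_coeff_pos])

lemma coth_coeff_Suc: "coth_coeff n k = 2 * (2 * n + 2 * k + 1) * coth_coeff (Suc n) k"
proof -
  define A B where "A = real (n + k + 1)" and "B = real (2 * n + 2 * k + 1)"
  have "2 * (Suc n + k) = Suc (Suc (2 * (n + k)))" by simp
  hence "fact (2 * (Suc n + k)) = 2 * A * B * (fact (2 * (n + k)) :: real)"
    unfolding A_def B_def by (simp only: fact_Suc) (simp add: algebra_simps)
  moreover have "fact (Suc n + k) = A * (fact (n + k) :: real)"
    by (simp add: A_def algebra_simps)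
  moreover have "A \<noteq> 0" "B \<noteq> 0" by (simp_all add: A_def B_def)
  ultimately have "coth_coeff n k = 2 * B * coth_coeff (Suc n) k"
    unfolding coth_coeff_def by (simp del: fact_Suc add_Suc mult_Suc_right)
  thus ?thesis by (simp add: B_def)
qed

lemma coth_coeff_shift: "coth_coeff (Suc n) k = 4 * Suc k * coth_coeff n (Suc k)"
  by (simp add: coth_coeff_def divide_simps)

lemma coth_coeff_rec_0: "coth_coeff n 0 = (4 * n + 2) * coth_coeff (Suc n) 0"
  by (simp add: coth_coeff_Suc[of n 0])

lemma coth_coeff_rec: "coth_coeff n (Suc k) = (4 * n + 2) * coth_coeff (Suc n) (Suc k) + coth_coeff (Suc (Suc n)) k"
  by (simp add: coth_coeff_Suc[of n "Suc k"] coth_coeff_shift[of "Suc n" k] algebra_simps)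

text \<open>
  The step \<open>n\<close> to \<open>n + 1\<close> of the continued fraction
  \<open>(e + 1) / (e - 1) = [2; 6, 10, 14, \<dots>]\<close>. Solving it repeatedly for the series of largest index
  gives integer combinations of \<open>cosh (1/2)\<close> and \<open>sinh (1/2)\<close> that are positive, because all the
  coefficients are, and that decrease fast.
\<close>

lemma coth_series_rec: "coth_series n = (4 * n + 2) * coth_series (Suc n) + coth_series (Suc (Suc n))"
proof -
  have s: "summable (\<lambda>k. coth_coeff m (Suc k))" for m
    using summable_coth_coeff[of m] by (subst summable_Suc_iff)
  have h: "coth_series m = (\<Sum>k. coth_coeff m (Suc k)) + coth_coeff m 0" for m
    unfolding coth_series_def using suminf_split_head[OF summable_coth_coeff[of m]] by simp
  have "(\<Sum>k. coth_coeff n (Suc k)) = (4 * n + 2) * (\<Sum>k. coth_coeff (Suc n) (Suc k)) + coth_series (Suc (Suc n))"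
    unfolding coth_series_def coth_coeff_rec[of n]
    by (simp add: suminf_add[symmetric] suminf_mult summable_mult s summable_coth_coeff
        del: of_nat_add of_nat_mult)
  thus ?thesis by (simp add: h[of n] h[of "Suc n"] coth_coeff_rec_0[of n] algebra_simps)
qed

text \<open>
  The series for \<open>n = 0\<close> and \<open>n = 1\<close> consist of the even and the odd terms of the
  exponential series at \<open>1/2\<close>.
\<close>

lemma coth_series_exp:
  shows "coth_series 0 + coth_series 1 = exp (1 / 2)" and "coth_series 0 - coth_series 1 = exp (- (1 / 2))"
proof -
  have c0: "coth_coeff 0 k = (1 / 2) ^ (2 * k) / fact (2 * k)" for k
    by (simp add: coth_coeff_def power_mult power_one_over power2_eq_square)
  have c1: "coth_coeff 1 k = (1 / 2) ^ (2 * k + 1) / fact (2 * k + 1)" for k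
  proof -
    define A where "A = real k + 1"
    have "fact (1 + k) = A * fact k" by (simp add: A_def)
    moreover have "fact (2 * (1 + k)) = 2 * A * fact (2 * k + 1)"
      by (simp add: A_def algebra_simps)
    moreover have "A \<noteq> 0" unfolding A_def by linarith
    ultimately have "coth_coeff 1 k = 1 / (2 * fact (2 * k + 1) * 4 ^ k)"
      unfolding coth_coeff_def by (simp del: fact_Suc add_Suc mult_Suc_right plus_1_eq_Suc distrib_left_numeral)
    also have "\<dots> = (1 / 2) ^ (2 * k + 1) / fact (2 * k + 1)"
      by (simp add: power_mult power_one_over power2_eq_square del: fact_Suc)
    finally show ?thesis .
  qed
  have S: "(\<lambda>k. x ^ (2 * k) / fact (2 * k) + x ^ (2 * k + 1) / fact (2 * k + 1)) sums exp x" for x :: real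
    using sums_group[OF exp_converges[of x], of 2]
    by (simp add: mult.commute[of _ 2] divide_inverse_commute)
  have "(\<lambda>k. coth_coeff 0 k + coth_coeff 1 k) sums exp (1 / 2)"
    unfolding c0 c1 by (rule S)
  moreover have "(\<lambda>k. coth_coeff 0 k + coth_coeff 1 k) sums (coth_series 0 + coth_series 1)"
    unfolding coth_series_def by (intro sums_add summable_sums summable_coth_coeff)
  ultimately show "coth_series 0 + coth_series 1 = exp (1 / 2)" by (rule sums_unique2[symmetric])
  have "(\<lambda>k. coth_coeff 0 k - coth_coeff 1 k) sums exp (- (1 / 2))"
    using S[of "- (1 / 2)"] unfolding c0 c1 by (simp add: power_minus')
  moreover have "(\<lambda>k. coth_coeff 0 k - coth_coeff 1 k) sums (coth_series 0 - coth_series 1)"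
    unfolding coth_series_def by (intro sums_diff summable_sums summable_coth_coeff)
  ultimately show "coth_series 0 - coth_series 1 = exp (- (1 / 2))" by (rule sums_unique2[symmetric])
qed

text \<open>
  Numerators and denominators of approximations \<open>1/1, 3/1, 19/7, 193/71, \<dots>\<close> to \<open>e\<close>. They follow the
  recurrence with partial quotients \<open>6, 10, 14, \<dots>\<close>, and the initial values make the errors
  proportional to the series above.
\<close>

fun e_den :: "nat \<Rightarrow> int" where
  "e_den 0 = 1"
| "e_den (Suc 0) = 1"
| "e_den (Suc (Suc n)) = (4 * int n + 6) * e_den (Suc n) + e_den n"

fun e_num :: "nat \<Rightarrow> int" where
  "e_num 0 = 1"
| "e_num (Suc 0) = 3"
| "e_num (Suc (Suc n)) = (4 * int n + 6) * e_num (Suc n) + e_num n"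

definition e_err :: "nat \<Rightarrow> real" where
  "e_err n = (- 1) ^ n * (e_den n * exp 1 - e_num n)"

lemma e_err_rec: "e_err n = (4 * n + 6) * e_err (Suc n) + e_err (Suc (Suc n))"
  by (simp add: e_err_def algebra_simps)

text \<open>
  Both sides satisfy the same recurrence, so only the first two values matter. In
  particular, the errors alternate in sign without any estimate being made.
\<close>

lemma e_err_eq_coth_series: "e_err n = 2 * exp (1 / 2) * coth_series (Suc n)"
proof (induction n rule: e_den.induct)
  case 1
  have "2 * coth_series 1 = exp (1 / 2) - exp (- (1 / 2))" using coth_series_exp by linarith
  hence "exp (1 / 2) * (2 * coth_series 1) = exp (1 / 2) * (exp (1 / 2) - exp (- (1 / 2)))" by simp
  also have "\<dots> = exp 1 - 1" by (simp add: right_diff_distrib flip: exp_add)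
  finally show ?case by (simp add: e_err_def)
next
  case 2
  have "2 * coth_series 2 = 3 * exp (- (1 / 2)) - exp (1 / 2)"
    using coth_series_exp coth_series_rec[of 0] by (simp add: numeral_2_eq_2)
  hence "exp (1 / 2) * (2 * coth_series 2) = exp (1 / 2) * (3 * exp (- (1 / 2)) - exp (1 / 2))" by simp
  also have "\<dots> = 3 - exp 1" by (simp add: right_diff_distrib mult.left_commute flip: exp_add)
  finally show ?case by (simp add: e_err_def numeral_2_eq_2)
next
  case (3 n)
  have "coth_series (Suc (Suc (Suc n))) = coth_series (Suc n) - (4 * n + 6) * coth_series (Suc (Suc n))"
    using coth_series_rec[of "Suc n"] by (simp add: algebra_simps)
  moreover have "e_err (Suc (Suc n)) = e_err n - (4 * n + 6) * e_err (Suc n)"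
    using e_err_rec[of n] by simp
  ultimately show ?case unfolding 3 by (simp only: right_diff_distrib mult.left_commute)
qed

lemma e_err_pos: "e_err n > 0"
  by (simp add: e_err_eq_coth_series coth_series_pos)

lemma e_err_Suc_le: "6 * e_err (Suc n) \<le> e_err n"
proof -
  have "e_err n - 6 * e_err (Suc n) = 4 * n * e_err (Suc n) + e_err (Suc (Suc n))"
    by (subst e_err_rec) (simp add: algebra_simps)
  moreover have "0 \<le> 4 * n * e_err (Suc n)"
    using e_err_pos[of "Suc n"] by (intro mult_nonneg_nonneg) auto
  ultimately show ?thesis using e_err_pos[of "Suc (Suc n)"] by linarith
qed

lemma e_err_le: "e_err n \<le> 2 / 2 ^ n"
proof (induction n)
  case 0
  show ?case using exp_le by (simp add: e_err_def)
next
  case (Suc n)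
  have "2 * e_err (Suc n) \<le> 6 * e_err (Suc n)" using e_err_pos[of "Suc n"] by simp
  also have "\<dots> \<le> 2 / 2 ^ n" using e_err_Suc_le[of n] Suc by linarith
  finally show ?case by simp
qed

lemma e_den_ge_1: "e_den n \<ge> 1"
proof (induction n rule: e_den.induct)
  case (3 n)
  have "0 \<le> (4 * int n + 6) * e_den (Suc n)" using 3 by (intro mult_nonneg_nonneg) auto
  thus ?case using 3(2) by simp
qed simp_all

lemma e_den_Suc_mono: "e_den n \<le> e_den (Suc n)"
proof (cases n)
  case (Suc m)
  have "1 * e_den (Suc m) \<le> (4 * int m + 6) * e_den (Suc m)"
    using e_den_ge_1[of "Suc m"] by (intro mult_right_mono) auto
  thus ?thesis using Suc e_den_ge_1[of m] by simp
qed simp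

lemma e_den_Suc_Suc_le: "e_den (Suc (Suc n)) \<le> (4 * int n + 7) * e_den (Suc n)"
  using e_den_Suc_mono[of n] by (simp add: algebra_simps)

lemma e_det: "e_den n * e_num (Suc n) - e_den (Suc n) * e_num n = 2 * (- 1) ^ n"
  by (induction n) (auto simp: algebra_simps)

text \<open>
  Since both summands are positive, this turns the smallness of the errors into an upper
  bound for the denominators.
\<close>

lemma e_den_e_err: "e_den (Suc n) * e_err n + e_den n * e_err (Suc n) = 2"
proof -
  have "e_den (Suc n) * e_err n + e_den n * e_err (Suc n)
      = (- 1) ^ n * real_of_int (e_den n * e_num (Suc n) - e_den (Suc n) * e_num n)"
    by (simp add: e_err_def algebra_simps)
  also have "\<dots> = 2 * ((- 1) ^ n * (- 1) ^ n)" by (simp add: e_det)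
  also have "\<dots> = 2" by (simp flip: power_mult_distrib)
  finally show ?thesis .
qed

text \<open>
  Compare \<open>p / q\<close> with the first approximation whose error is at most \<open>1 / (2 q)\<close>, or with
  the next one: at least one of the two differs from \<open>p / q\<close>, and this difference is a fraction
  whose denominator is known. The index of that approximation is \<open>O(ln q)\<close>, which bounds
  the partial quotients involved and gives the logarithm.
\<close>

theorem e_irrationality_measure:
  fixes p q :: int
  assumes q: "q \<ge> 1"
  shows "\<bar>q * exp 1 - p\<bar> \<ge> 1 / (120 * q * (1 + ln q))"
proof -
  define L where "L = \<bar>q * exp 1 - p\<bar>"
  have ex: "\<exists>n. q * e_err n \<le> 1 / 2"
  proof -
    obtain n where "4 * real_of_int q < 2 ^ n" using real_arch_pow[of 2] by auto
    moreover have "q * e_err n \<le> q * (2 / 2 ^ n)"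
      using q by (intro mult_left_mono e_err_le) auto
    moreover have "q * (2 / 2 ^ n) \<le> (1 / 2 :: real)" using calculation(1) by (simp add: divide_simps)
    ultimately have "q * e_err n \<le> 1 / 2" by (meson order_trans)
    thus ?thesis ..
  qed
  define n where "n = (LEAST n. q * e_err n \<le> 1 / 2)"
  have n: "q * e_err n \<le> 1 / 2" unfolding n_def using ex by (rule LeastI_ex)
  have "e_err 0 > 1 / 2"
    using exp_ge_add_one_self[of "1 :: real"] by (simp add: e_err_def)
  hence "q * e_err 0 > 1 / 2"
    using q mult_right_mono[of 1 "real_of_int q" "e_err 0"] e_err_pos[of 0] by linarith
  with n have "n \<noteq> 0" by (intro notI) simp
  then obtain k where k: "n = Suc k" using not0_implies_Suc by blast
  have "k < n" by (simp add: k)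
  hence "\<not> q * e_err k \<le> 1 / 2" unfolding n_def by (rule not_less_Least)
  hence qk: "q * e_err k > 1 / 2" by simp
  have "q * e_err (Suc n) \<le> q * e_err n"
    using q e_err_Suc_le[of n] e_err_pos[of "Suc n"] by (intro mult_left_mono) auto
  with n have n': "q * e_err (Suc n) \<le> 1 / 2" by simp
  \<comment> \<open>A nonzero integer has absolute value at least 1, and the error of the approximation accounts
  for at most half of it.\<close>
  have main: "1 / 2 \<le> e_den (Suc n) * L" if ne: "e_den m * p \<noteq> e_num m * q" and m: "m = n \<or> m = Suc n" for m
  proof -
    have "1 \<le> \<bar>e_den m * p - e_num m * q\<bar>" using ne by linarith
    hence "1 \<le> \<bar>real_of_int (e_den m * p - e_num m * q)\<bar>" by linarith
    also have "real_of_int (e_den m * p - e_num m * q)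
        = q * (e_den m * exp 1 - e_num m) - e_den m * (q * exp 1 - p)"
      by (simp add: algebra_simps)
    also have "\<bar>\<dots>\<bar> \<le> \<bar>q * (e_den m * exp 1 - e_num m)\<bar> + \<bar>e_den m * (q * exp 1 - p)\<bar>"
      by linarith
    also have "\<bar>q * (e_den m * exp 1 - e_num m)\<bar> = q * \<bar>e_err m\<bar>"
      using q by (simp add: abs_mult e_err_def)
    also have "\<bar>e_err m\<bar> = e_err m" using e_err_pos[of m] by simp
    also have "\<bar>e_den m * (q * exp 1 - p)\<bar> = e_den m * L"
      using e_den_ge_1[of m] by (simp add: abs_mult L_def)
    finally have "1 / 2 \<le> e_den m * L" using m n n' by auto
    also have "\<dots> \<le> e_den (Suc n) * L"
      using m e_den_Suc_mono[of n] by (intro mult_right_mono) (auto simp: L_def)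
    finally show ?thesis .
  qed
  have "\<exists>m. (m = n \<or> m = Suc n) \<and> e_den m * p \<noteq> e_num m * q"
  proof (rule ccontr)
    assume "\<not> ?thesis"
    hence eq: "e_num n * q = e_den n * p" "e_num (Suc n) * q = e_den (Suc n) * p" by auto
    have "q * (e_den n * e_num (Suc n) - e_den (Suc n) * e_num n)
        = e_den n * (e_num (Suc n) * q) - e_den (Suc n) * (e_num n * q)"
      by (simp add: algebra_simps)
    hence "q * (e_den n * e_num (Suc n) - e_den (Suc n) * e_num n) = 0"
      unfolding eq by (simp add: algebra_simps)
    thus False using q unfolding e_det by simp
  qed
  with main have half: "1 / 2 \<le> e_den (Suc n) * L" by blast
  have "e_den n * e_err k \<le> 2"
  proof -
    have "0 \<le> e_den k * e_err (Suc k)"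
      using e_den_ge_1[of k] e_err_pos[of "Suc k"] by (intro mult_nonneg_nonneg) auto
    thus ?thesis using e_den_e_err[of k] unfolding k by linarith
  qed
  also have "2 < 4 * real_of_int q * e_err k" using qk by linarith
  finally have "e_den n * e_err k < (4 * real_of_int q) * e_err k" .
  hence dn: "e_den n < 4 * real_of_int q" by (rule mult_right_less_imp_less) (use e_err_pos[of k] in linarith)
  have "real_of_int (e_den (Suc n)) \<le> real_of_int ((4 * int k + 7) * e_den n)"
    using e_den_Suc_Suc_le[of k] unfolding k of_int_le_iff .
  also have "\<dots> = (4 * k + 7) * real_of_int (e_den n)" by simp
  also have "\<dots> \<le> (4 * k + 7) * (4 * real_of_int q)" using dn by (intro mult_left_mono) auto
  finally have dS: "e_den (Suc n) \<le> (4 * k + 7) * (4 * real_of_int q)" by simp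
  \<comment> \<open>The errors decrease geometrically, so \<open>k\<close> is at most logarithmic in \<open>q\<close>.\<close>
  have "1 / 2 < q * (2 / 2 ^ k)"
    using qk mult_left_mono[OF e_err_le[of k], of "real_of_int q"] q by linarith
  hence "2 ^ k < 4 * real_of_int q" by (simp add: field_simps)
  moreover have "(0 :: real) < 2 ^ k" by simp
  ultimately have "ln (2 ^ k :: real) < ln (4 * real_of_int q)"
    by (metis ln_less_cancel_iff order.strict_trans)
  moreover have "ln (4 * real_of_int q) = ln 4 + ln q" using q by (simp add: ln_mult)
  moreover have "ln (4 :: real) = 2 * ln 2" using ln_realpow[of "2 :: real" 2] by simp
  moreover have "ln (2 ^ k :: real) = k * ln 2" by (simp add: ln_realpow)
  ultimately have kq: "(real k - 2) * ln 2 < ln q" unfolding left_diff_distrib by linarith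
  have lnq: "ln (real_of_int q) \<ge> 0" using q by simp
  have ln2: "ln (2 :: real) \<ge> 1 / 2" using ln2_ge_two_thirds by linarith
  have "real k - 2 \<le> 2 * ln q"
  proof (cases "k \<ge> 2")
    case True
    hence "(real k - 2) * (1 / 2) \<le> (real k - 2) * ln 2" using ln2 by (intro mult_left_mono) auto
    from this kq have "(real k - 2) * (1 / 2) < ln q" by (rule le_less_trans)
    thus ?thesis by simp
  qed (use lnq in simp)
  hence "4 * real k + 7 \<le> 15 * (1 + ln q)" using lnq by simp
  hence "(4 * k + 7) * (4 * real_of_int q) \<le> 15 * (1 + ln q) * (4 * real_of_int q)"
    using q by (intro mult_right_mono) auto
  with dS have "e_den (Suc n) \<le> 15 * (1 + ln q) * (4 * real_of_int q)" by (rule order_trans)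
  also have "\<dots> = 60 * real_of_int q * (1 + ln q)" by simp
  finally have "e_den (Suc n) \<le> 60 * real_of_int q * (1 + ln q)" .
  hence "e_den (Suc n) * L \<le> 60 * real_of_int q * (1 + ln q) * L"
    by (rule mult_right_mono) (simp add: L_def)
  with half have "1 \<le> L * (120 * q * (1 + ln q))" by (simp add: algebra_simps)
  moreover have "120 * real_of_int q * (1 + ln q) > 0"
  proof (intro mult_pos_pos)
    show "0 < 1 + ln (real_of_int q)" using lnq by linarith
  qed (use q in auto)
  ultimately show ?thesis unfolding L_def[symmetric] by (simp add: pos_divide_le_eq)
qed

section \<open>Repeated blocks in an aperiodic word\<close>

definition repeats :: "(nat \<Rightarrow> 'a) \<Rightarrow> nat \<Rightarrow> nat \<Rightarrow> nat \<Rightarrow> bool" where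
  "repeats a i j n \<longleftrightarrow> i < j \<and> (\<forall>t<n. a (i + t) = a (j + t))"

definition first_repeat :: "(nat \<Rightarrow> 'a) \<Rightarrow> nat \<Rightarrow> nat \<Rightarrow> nat \<Rightarrow> bool" where
  "first_repeat a n i j \<longleftrightarrow> repeats a i j n \<and> (\<forall>i' j'. repeats a i' j' n \<longrightarrow> j \<le> j')"

text \<open>
  The combinatorial trace of an irrationality exponent equal to 2: a block that recurs at
  position \<open>j\<close> is hardly longer than \<open>j\<close>. The slack \<open>\<tau>\<close> is sublinear in the range \<open>M\<close> in the
  application.
\<close>

definition short_repeats :: "(nat \<Rightarrow> 'a) \<Rightarrow> nat \<Rightarrow> nat \<Rightarrow> bool" where
  "short_repeats a M \<tau> \<longleftrightarrow> (\<forall>i j n. repeats a i j n \<longrightarrow> j \<le> M \<longrightarrow> n \<le> j + \<tau>)"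

definition blocks :: "(nat \<Rightarrow> 'a) \<Rightarrow> nat \<Rightarrow> 'a list set" where
  "blocks a n = range (\<lambda>j. block a j n)"

lemma block_eq_iff: "block a i n = block a j n \<longleftrightarrow> (\<forall>t<n. a (i + t) = a (j + t))"
  by (auto simp: block_def)

lemma repeats_iff_block: "repeats a i j n \<longleftrightarrow> i < j \<and> block a i n = block a j n"
  by (simp add: repeats_def block_eq_iff)

lemma short_repeatsD: "short_repeats a M \<tau> \<Longrightarrow> repeats a i j n \<Longrightarrow> j \<le> M \<Longrightarrow> n \<le> j + \<tau>"
  by (simp add: short_repeats_def)

lemma short_repeats_mono: "short_repeats a M \<tau> \<Longrightarrow> M' \<le> M \<Longrightarrow> short_repeats a M' \<tau>"
  by (auto simp: short_repeats_def)

locale aperiodic_word =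
  fixes a :: "nat \<Rightarrow> 'a"
  assumes finite_range: "finite (range a)"
    and not_periodic: "i < j \<Longrightarrow> \<exists>n. \<not> repeats a i j n"
begin

lemma finite_blocks:
  shows "finite (blocks a n)"
proof (rule finite_subset)
  show "blocks a n \<subseteq> {xs. set xs \<subseteq> range a \<and> length xs = n}"
    by (auto simp: blocks_def block_def)
  show "finite {xs. set xs \<subseteq> range a \<and> length xs = n}"
    using finite_range by (rule finite_lists_length_eq)
qed

text \<open>
  The pigeonhole principle on the first \<open>p(n) + 1\<close> positions, where \<open>p(n)\<close> is the number of blocks.
\<close>

lemma ex_repeats: "\<exists>i j. repeats a i j n \<and> j \<le> card (blocks a n)"
proof -
  let ?p = "card (blocks a n)"
  have "card ((\<lambda>j. block a j n) ` {..?p}) \<le> ?p"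
    by (intro card_mono finite_blocks) (auto simp: blocks_def)
  hence "\<not> inj_on (\<lambda>j. block a j n) {..?p}" by (intro pigeonhole) simp
  then obtain i j where "i \<le> ?p" "j \<le> ?p" "i \<noteq> j" "block a i n = block a j n"
    by (auto simp: inj_on_def)
  thus ?thesis by (metis nat_neq_iff repeats_iff_block)
qed

lemma first_repeat_le:
  assumes "first_repeat a n i j"
  shows "j \<le> card (blocks a n)"
  using ex_repeats[of n] assms unfolding first_repeat_def by (meson order_trans)

lemma ex_first_repeat:
  assumes "repeats a i j n"
  shows "\<exists>i' j'. first_repeat a n i' j' \<and> j' \<le> j"
proof -
  let ?P = "\<lambda>j. \<exists>i. repeats a i j n"
  have "?P j" using assms by blast
  hence "?P (Least ?P)" "Least ?P \<le> j" by (rule LeastI, rule Least_le)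
  moreover have "Least ?P \<le> j'" if "repeats a i' j' n" for i' j'
    using that by (intro Least_le) blast
  ultimately show ?thesis unfolding first_repeat_def by blast
qed

text \<open>
  The Morse--Hedlund argument: if no block of length \<open>n\<close> has two extensions, every repeat of
  length \<open>n\<close> propagates to the right forever.
\<close>

lemma card_blocks_Suc: "card (blocks a n) < card (blocks a (Suc n))"
proof (rule ccontr)
  assume "\<not> ?thesis"
  moreover have im: "take n ` blocks a (Suc n) = blocks a n"
  proof -
    have "take n (block a j (Suc n)) = block a j n" for j by (simp add: block_def)
    thus ?thesis unfolding blocks_def image_image by simp
  qed
  ultimately have "card (take n ` blocks a (Suc n)) = card (blocks a (Suc n))"
    using card_image_le[OF finite_blocks, of "take n" "Suc n"] by simp
  hence inj: "inj_on (take n) (blocks a (Suc n))"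
    by (intro eq_card_imp_inj_on finite_blocks)
  have ext: "repeats a i j (Suc n)" if "repeats a i j n" for i j
  proof -
    have "take n (block a i (Suc n)) = take n (block a j (Suc n))"
      using that by (simp add: repeats_iff_block) (simp add: block_def)
    hence "block a i (Suc n) = block a j (Suc n)"
      using inj by (auto simp: inj_on_def blocks_def)
    thus ?thesis using that by (simp add: repeats_iff_block)
  qed
  obtain i j where ij: "repeats a i j n" using ex_repeats by blast
  have shift: "repeats a (i + t) (j + t) n" for t
  proof (induction t)
    case (Suc t)
    from ext[OF this] have "i < j" and eq: "\<forall>u<Suc n. a (i + t + u) = a (j + t + u)"
      by (auto simp: repeats_def)
    have "a (i + Suc t + u) = a (j + Suc t + u)" if "u < n" for u
      using eq[rule_format, of "Suc u"] that by simp
    thus ?case using \<open>i < j\<close> by (simp add: repeats_def)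
  qed (use ij in simp)
  have "a (i + t) = a (j + t)" for t
    using ext[OF shift[of t]] unfolding repeats_def by (metis add.right_neutral zero_less_Suc)
  hence "repeats a i j N" for N using ij by (simp add: repeats_def)
  thus False using not_periodic ij unfolding repeats_def by blast
qed

lemma card_blocks_add: "card (blocks a m) + k \<le> card (blocks a (m + k))"
proof (induction k)
  case (Suc k)
  thus ?case using card_blocks_Suc[of "m + k"] by simp
qed simp

lemma card_blocks_ge: "Suc n \<le> card (blocks a n)"
  using card_blocks_add[of 0 n] by (simp add: blocks_def block_def)

lemma card_blocks_excess:
  assumes "card (blocks a n) \<le> n + f" "m \<le> n"
  shows "card (blocks a m) \<le> m + f"
  using card_blocks_add[of m "n - m"] assms by simp

text \<open>
  The word has period \<open>l = j - i\<close> on one stretch and \<open>l' = j' - i'\<close> on another. If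
  \<open>l + l'\<close> fits into their common part, then going from position \<open>j + n\<close> back by \<open>l'\<close>, back by
  \<open>l\<close> and forward by \<open>l'\<close> never leaves the stretches, so the letter at \<open>j + n\<close> equals the one at
  \<open>i + n\<close>, and the first repeat extends by one letter.
\<close>

lemma repeats_overlap:
  assumes r: "repeats a i j n" and mx: "\<not> repeats a i j (Suc n)"
    and r': "repeats a i' j' n'" and "j < j'" "n < n'"
  shows "n + min i i' < j'"
proof (rule ccontr)
  assume "\<not> ?thesis"
  hence ge: "j' \<le> n + i" "j' \<le> n + i'" by auto
  have lt: "i < j" "i' < j'" using r r' by (auto simp: repeats_def)
  have A: "a (i + t) = a (j + t)" if "t < n" for t using r that by (simp add: repeats_def)
  have A': "a (i' + t) = a (j' + t)" if "t < n'" for t using r' that by (simp add: repeats_def)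
  have "a (j + n) = a (i' + (j + n - j'))"
    using A'[of "j + n - j'"] ge lt assms by simp
  also have "i' + (j + n - j') = j + (i' + n - j')" using ge lt assms(4) by simp
  also have "a \<dots> = a (i + (i' + n - j'))"
    using A[of "i' + n - j'"] ge lt by simp
  also have "i + (i' + n - j') = i' + (i + n - j')" using ge by simp
  also have "a \<dots> = a (j' + (i + n - j'))"
    using A'[of "i + n - j'"] ge lt assms by simp
  also have "j' + (i + n - j') = i + n" using ge by simp
  finally have "repeats a i j (Suc n)"
    using r by (auto simp: repeats_def less_Suc_eq)
  with mx show False ..
qed

text \<open>
  With \<open>D = j' - j\<close>, the block of length \<open>n - D\<close> at \<open>j'\<close> also occurs at \<open>i + D\<close> and at \<open>i'\<close>.
  These two positions differ, since otherwise the first repeat could be extended; so they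
  form a repeat, and both are close to the origin.
\<close>

lemma repeats_compare:
  assumes r: "repeats a i j n" and mx: "\<not> repeats a i j (Suc n)"
    and r': "repeats a i' j' n'" and lt: "j < j'" "n < n'"
    and few: "short_repeats a j' \<tau>"
    and f: "i \<le> f" "i' \<le> f"
  shows "n \<le> 2 * (j' - j) + f + \<tau>"
proof (cases "n \<le> j' - j")
  case False
  define D where "D = j' - j"
  have D: "D < n" "j + D = j'" using False lt by (auto simp: D_def)
  have ij: "i < j" "i' < j'" using r r' by (auto simp: repeats_def)
  have A: "a (i + t) = a (j + t)" if "t < n" for t using r that by (simp add: repeats_def)
  have A': "a (i' + t) = a (j' + t)" if "t < n'" for t using r' that by (simp add: repeats_def)
  have same: "a (i + D + t) = a (i' + t)" if "t < n - D" for t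
    using A[of "D + t"] A'[of t] that D lt by (simp add: add.assoc[symmetric])
  have "i + D \<noteq> i'"
  proof
    assume "i + D = i'"
    hence "i + n = i' + (n - D)" using D by simp
    hence "a (i + n) = a (i' + (n - D))" by simp
    also have "\<dots> = a (j' + (n - D))" using D lt by (intro A') simp
    also have "j' + (n - D) = j + n" using D by simp
    finally have "repeats a i j (Suc n)"
      using r by (auto simp: repeats_def less_Suc_eq)
    with mx show False ..
  qed
  then consider "i + D < i'" | "i' < i + D" by linarith
  thus ?thesis
  proof cases
    case 1
    hence "repeats a (i + D) i' (n - D)" using same by (simp add: repeats_def)
    from short_repeatsD[OF few this] show ?thesis using f ij unfolding D_def by simp
  next
    case 2
    hence "repeats a i' (i + D) (n - D)" using same by (simp add: repeats_def)
    from short_repeatsD[OF few this] show ?thesis using f ij D unfolding D_def[symmetric] by simp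
  qed
qed simp

text \<open>
  The last jump of the first-repeat position below \<open>n\<close>. At the length \<open>n1 + 1\<close> just after
  the jump, that position is already at least \<open>j\<close>, so the number of blocks of this length bounds
  \<open>j\<close>.
\<close>

lemma previous_first_repeat:
  assumes fr: "first_repeat a n i j" and j: "j > 1"
  obtains n1 i1 j1 where "n1 < n" "j1 < j" "first_repeat a n1 i1 j1" "\<not> repeats a i1 j1 (Suc n1)"
    "j \<le> card (blocks a (Suc n1))"
proof -
  let ?P = "\<lambda>m. \<exists>i1 j1. first_repeat a m i1 j1 \<and> j1 < j"
  have "repeats a 0 1 0" by (simp add: repeats_def)
  from ex_first_repeat[OF this] have P0: "?P 0" using j by (meson le_less_trans)
  have nP: "\<not> ?P n" using fr unfolding first_repeat_def by (meson leD)
  define k where "k = (LEAST m. \<not> ?P m)"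
  have k: "\<not> ?P k" "k \<le> n" unfolding k_def
    using nP by (rule LeastI, intro Least_le nP)
  with P0 have "k \<noteq> 0" by (intro notI) simp
  then obtain n1 where n1: "k = Suc n1" using not0_implies_Suc by blast
  have "?P n1" using not_less_Least[of n1 "\<lambda>m. \<not> ?P m"] n1 unfolding k_def by simp
  then obtain i1 j1 where 1: "first_repeat a n1 i1 j1" "j1 < j" by blast
  have "\<not> repeats a i1 j1 (Suc n1)"
    using ex_first_repeat[of i1 j1 "Suc n1"] k(1) 1(2) unfolding n1 by (meson le_less_trans)
  moreover have "j \<le> card (blocks a (Suc n1))"
  proof -
    obtain i2 j2 where "repeats a i2 j2 (Suc n1)" "j2 \<le> card (blocks a (Suc n1))"
      using ex_repeats by blast
    moreover from ex_first_repeat[OF this(1)] k(1) have "j \<le> j2"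
      unfolding n1 by (meson le_less_trans not_le)
    ultimately show ?thesis by simp
  qed
  ultimately show ?thesis using that 1 k n1 by (meson Suc_le_eq)
qed

lemma first_repeat_descent:
  assumes few: "short_repeats a j \<tau>"
    and p: "card (blocks a n) \<le> n + f"
    and fr: "first_repeat a n i j" and n: "n > f + \<tau> + 1"
  obtains n1 i1 j1 where "n1 < n" "j1 < j" "first_repeat a n1 i1 j1" "\<not> repeats a i1 j1 (Suc n1)"
    "j \<le> card (blocks a (Suc n1))" "card (blocks a n1) \<le> n1 + f"
    "n1 + min i1 i < j" "j \<le> n1 + f + 1" "j \<le> j1 + (f + \<tau> + 1)" "n \<le> n1 + (f + \<tau> + 1)"
proof -
  have r: "repeats a i j n" using fr by (simp add: first_repeat_def)
  have nj: "n \<le> j + \<tau>" using short_repeatsD[OF few r] by simp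
  hence "j > 1" using n by simp
  from previous_first_repeat[OF fr this] obtain n1 i1 j1 where
    1: "n1 < n" "j1 < j" "first_repeat a n1 i1 j1" "\<not> repeats a i1 j1 (Suc n1)"
      "j \<le> card (blocks a (Suc n1))" .
  have r1: "repeats a i1 j1 n1" using 1 by (simp add: first_repeat_def)
  have p1: "card (blocks a m) \<le> m + f" if "m \<le> n" for m
    by (rule card_blocks_excess[OF p that])
  show ?thesis
  proof (rule that[OF 1])
    show "card (blocks a n1) \<le> n1 + f" using p1[of n1] 1 by simp
    show *: "j \<le> n1 + f + 1" using p1[of "Suc n1"] 1 by simp
    show "n1 + min i1 i < j" by (rule repeats_overlap[OF r1 1(4) r 1(2,1)])
    show "j \<le> j1 + (f + \<tau> + 1)" using * short_repeatsD[OF few r1] 1 by simp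
    show "n \<le> n1 + (f + \<tau> + 1)" using * nj by simp
  qed
qed

text \<open>
  If the repeat at the preceding jump is early, compare with it; otherwise, by the
  overlap argument, the one before that is early, and lies at most two jumps below. The second case
  is the worse one: length at least \<open>n - 2 g\<close> and distance at most \<open>2 g\<close>, where
  \<open>g = f + \<tau> + 1\<close>, so that \<open>n - 2 g \<le> 4 g + g\<close>.
\<close>

lemma first_repeat_early_imp_excess:
  assumes few: "short_repeats a j \<tau>"
    and p: "card (blocks a n) \<le> n + f"
    and fr: "first_repeat a n i j" and i: "i \<le> f"
  shows "n \<le> 7 * (f + \<tau> + 1)"
proof (rule ccontr)
  assume big: "\<not> ?thesis"
  have r: "repeats a i j n" using fr by (simp add: first_repeat_def)
  from big have "n > f + \<tau> + 1" by simp
  from first_repeat_descent[OF few p fr this] obtain n1 i1 j1 where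
    1: "n1 < n" "j1 < j" "first_repeat a n1 i1 j1" "\<not> repeats a i1 j1 (Suc n1)"
      "card (blocks a n1) \<le> n1 + f" "j \<le> j1 + (f + \<tau> + 1)" "n \<le> n1 + (f + \<tau> + 1)"
    by metis
  have r1: "repeats a i1 j1 n1" using 1 by (simp add: first_repeat_def)
  show False
  proof (cases "i1 \<le> f")
    case True
    from repeats_compare[OF r1 1(4) r 1(2,1) few True i]
    show False using 1 big by simp
  next
    case False
    have few1: "short_repeats a j1 \<tau>"
      using short_repeats_mono[OF few] 1 by simp
    have "n1 > f + \<tau> + 1" using big 1 by simp
    from first_repeat_descent[OF few1 1(5,3) this] obtain n2 i2 j2 where
      2: "n2 < n1" "j2 < j1" "first_repeat a n2 i2 j2" "\<not> repeats a i2 j2 (Suc n2)"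
        "n2 + min i2 i1 < j1" "j1 \<le> n2 + f + 1" "j1 \<le> j2 + (f + \<tau> + 1)" "n1 \<le> n2 + (f + \<tau> + 1)"
      by metis
    have r2: "repeats a i2 j2 n2" using 2 by (simp add: first_repeat_def)
    have i2: "i2 \<le> f" using 2 False by simp
    have "j2 < j" "n2 < n" using 1 2 by auto
    from repeats_compare[OF r2 2(4) r this few i2 i]
    show False using 1 2 big by simp
  qed
qed

text \<open>
  One more \<open>f + \<tau> + 1\<close> than in the early case is lost when the repeat at \<open>n\<close> is not early and the one at the
  preceding jump has to be used.
\<close>

lemma excess_lower_bound:
  assumes few: "short_repeats a (2 * n) \<tau>"
    and p: "card (blocks a n) \<le> n + f" and "f \<le> n"
  shows "n \<le> 8 * (f + \<tau> + 1)"
proof (rule ccontr)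
  assume big: "\<not> ?thesis"
  obtain i j where fr: "first_repeat a n i j"
    using ex_repeats ex_first_repeat by metis
  have "j \<le> 2 * n" using first_repeat_le[OF fr] p \<open>f \<le> n\<close> by simp
  hence few0: "short_repeats a j \<tau>"
    using short_repeats_mono[OF few] by simp
  from big have "n > f + \<tau> + 1" by simp
  from first_repeat_descent[OF few0 p fr this] obtain n1 i1 j1 where
    1: "n1 < n" "j1 < j" "first_repeat a n1 i1 j1" 
      "card (blocks a n1) \<le> n1 + f" "n1 + min i1 i < j" "j \<le> n1 + f + 1" "n \<le> n1 + (f + \<tau> + 1)"
    by metis
  have few1: "short_repeats a j1 \<tau>"
    using short_repeats_mono[OF few0] 1 by simp
  from 1 have "i \<le> f \<or> i1 \<le> f" by linarith
  thus False
  proof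
    assume "i \<le> f"
    from first_repeat_early_imp_excess[OF few0 p fr this] show False using big by simp
  next
    assume "i1 \<le> f"
    from first_repeat_early_imp_excess[OF few1 1(4,3) this] show False using big 1 by simp
  qed
qed

text \<open>
  If the repeat at \<open>n\<close> is not early, the one just before the preceding jump is, and the
  constant 7 applies there. The length after that jump is taken, \<open>m = n1 + 1\<close>, because it is the
  number of blocks of that length that bounds the start of the repeat in terms of
  the excess at \<open>m\<close> itself, rather than of the possibly larger excess at \<open>n\<close>.
\<close>

lemma excess_lower_bound_nearby:
  assumes few: "short_repeats a (2 * n) \<tau>"
    and p: "card (blocks a n) \<le> n + f" and "f \<le> n" and n: "n > f + \<tau> + 1"
  obtains m where "m \<le> n" "n \<le> m + (f + \<tau> + 1)" "8 * m \<le> 7 * (card (blocks a m) + \<tau> + 2)"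
proof -
  obtain i j where fr: "first_repeat a n i j"
    using ex_repeats ex_first_repeat by metis
  have "j \<le> 2 * n" using first_repeat_le[OF fr] p \<open>f \<le> n\<close> by simp
  hence few0: "short_repeats a j \<tau>"
    using short_repeats_mono[OF few] by simp
  from first_repeat_descent[OF few0 p fr n] obtain n1 i1 j1 where
    1: "n1 < n" "j1 < j" "first_repeat a n1 i1 j1" "j \<le> card (blocks a (Suc n1))"
      "n1 + min i1 i < j" "n \<le> n1 + (f + \<tau> + 1)"
    by metis
  have few1: "short_repeats a j1 \<tau>"
    using short_repeats_mono[OF few0] 1 by simp
  define f0 where "f0 = card (blocks a n) - n"
  define f1 where "f1 = card (blocks a (Suc n1)) - Suc n1"
  have p0: "card (blocks a n) = n + f0" and p1: "card (blocks a (Suc n1)) = Suc n1 + f1"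
    using card_blocks_ge[of n] card_blocks_ge[of "Suc n1"] by (simp_all add: f0_def f1_def)
  have "f1 \<le> f0" using card_blocks_excess[of n f0 "Suc n1"] p0 p1 1 by simp
  moreover have "min i1 i \<le> f1" using 1 p1 by simp
  ultimately consider "i \<le> f0" | "i1 \<le> f1" by linarith
  thus ?thesis
  proof cases
    case 1
    from first_repeat_early_imp_excess[OF few0 _ fr this] p0
    have "n \<le> 7 * (f0 + \<tau> + 1)" by simp
    thus ?thesis using that[of n] p0 by simp
  next
    case 2
    have "card (blocks a n1) \<le> n1 + f1"
      using card_blocks_excess[of "Suc n1" f1 n1] p1 by simp
    from first_repeat_early_imp_excess[OF few1 this 1(3) 2]
    have "n1 \<le> 7 * (f1 + \<tau> + 1)" .
    thus ?thesis using that[of "Suc n1"] 1 p1 by simp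
  qed
qed

end

section \<open>Repeated blocks in the digits of e\<close>

text \<open>
  Multiplying by \<open>b\<^sup>i\<close> and by \<open>b\<^sup>j\<close> shifts the two occurrences to the start of the fractional part, so
  the two multiples have fractional parts that agree in their first \<open>n\<close> digits.
\<close>

lemma repeats_digits_near_integer:
  assumes b: "b \<ge> 2" and r: "repeats (digits b \<xi>) i j n"
  shows "\<exists>p::int. \<bar>(real b ^ j - real b ^ i) * \<xi> - p\<bar> \<le> 1 / real b ^ n"
proof -
  define a where "a = digits b \<xi>"
  define F where "F m = \<lfloor>real b ^ m * frac \<xi>\<rfloor>" for m
  define S where "S m = (\<Sum>k<m. real (a k) / real b ^ (k + 1))" for m
  have B: "real b > 0" using b by simp
  have S: "S m = F m / real b ^ m" for m
    unfolding S_def F_def a_def by (rule expansion_partial_sum[OF b is_expansion_digits[OF b]])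
  define T where "T m = (\<Sum>t<n. real (a (m + t)) / real b ^ (t + 1))" for m
  have T: "real b ^ m * S (m + n) = F m + T m" for m
  proof -
    have "S (m + n) = S m + (\<Sum>t<n. real (a (m + t)) / real b ^ (m + t + 1))"
      unfolding S_def by (induction n) auto
    moreover have "real b ^ m * (\<Sum>t<n. real (a (m + t)) / real b ^ (m + t + 1)) = T m"
      unfolding T_def sum_distrib_left
      by (intro sum.cong refl) (use B in \<open>simp add: power_add\<close>)
    ultimately show ?thesis using B S[of m] by (simp add: distrib_left)
  qed
  have approx: "0 \<le> real b ^ m * frac \<xi> - (F m + T m) \<and>
      real b ^ m * frac \<xi> - (F m + T m) \<le> 1 / real b ^ n" for m
  proof -
    define X where "X = real b ^ m * frac \<xi> - (F m + T m)"
    have "real b ^ (m + n) * frac \<xi> - F (m + n) = real b ^ n * X"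
      unfolding X_def T[symmetric] S using B by (simp add: power_add algebra_simps)
    moreover have "0 \<le> real b ^ (m + n) * frac \<xi> - F (m + n)"
        "real b ^ (m + n) * frac \<xi> - F (m + n) \<le> 1"
      unfolding F_def by linarith+
    ultimately have "0 \<le> real b ^ n * X" "real b ^ n * X \<le> 1" by simp_all
    moreover have "real b ^ n > 0" using B by simp
    ultimately show ?thesis unfolding X_def[symmetric]
      by (simp add: zero_le_mult_iff pos_le_divide_eq mult.commute)
  qed
  have "T i = T j" using r by (simp add: T_def a_def repeats_def)
  hence "\<bar>(real b ^ j - real b ^ i) * frac \<xi> - of_int (F j - F i)\<bar> \<le> 1 / real b ^ n"
    using approx[of i] approx[of j] unfolding left_diff_distrib of_int_diff by linarith
  also have "(real b ^ j - real b ^ i) * frac \<xi> - of_int (F j - F i)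
      = (real b ^ j - real b ^ i) * \<xi> - of_int (F j - F i + (int b ^ j - int b ^ i) * \<lfloor>\<xi>\<rfloor>)"
    by (simp add: frac_def algebra_simps)
  finally show ?thesis by blast
qed

lemma repeats_digits_e:
  assumes b: "b \<ge> 2" and r: "repeats (digits b (exp 1)) i j n"
  shows "real b ^ n \<le> 120 * (1 + ln b) * (real j + 1) * real b ^ j"
proof -
  have ij: "i < j" using r by (simp add: repeats_def)
  define q where "q = int b ^ j - int b ^ i"
  have "int b ^ i < int b ^ j" using b ij by simp
  hence q: "q \<ge> 1" "q \<le> int b ^ j" by (auto simp: q_def)
  hence qr: "real_of_int q \<ge> 1" by simp
  have "real_of_int q \<le> real_of_int (int b ^ j)" using q(2) by (simp only: of_int_le_iff)
  hence qb: "real_of_int q \<le> real b ^ j" by simp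
  obtain p :: int where "\<bar>(real b ^ j - real b ^ i) * exp 1 - p\<bar> \<le> 1 / real b ^ n"
    using repeats_digits_near_integer[OF b r] by blast
  hence "\<bar>q * exp 1 - p\<bar> \<le> 1 / real b ^ n" by (simp add: q_def)
  hence le: "1 / (120 * real_of_int q * (1 + ln q)) \<le> 1 / real b ^ n"
    using e_irrationality_measure[OF q(1), of p] by simp
  have "real b ^ n \<le> 120 * real_of_int q * (1 + ln q)"
  proof -
    have "0 < 120 * real_of_int q * (1 + ln q)" using qr by (intro mult_pos_pos add_pos_nonneg) auto
    moreover have "0 < real b ^ n" using b by simp
    moreover note le
    ultimately show ?thesis by (simp add: divide_simps)
  qed
  also have "\<dots> \<le> 120 * real b ^ j * (1 + ln (real b ^ j))"
  proof -
    have "ln q \<le> ln (real b ^ j)" using qr qb by (subst ln_le_cancel_iff) linarith+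
    thus ?thesis using qr qb by (intro mult_mono add_mono) auto
  qed
  also have "\<dots> = 120 * real b ^ j * (1 + j * ln b)" using b by (simp add: ln_realpow)
  also have "\<dots> \<le> 120 * real b ^ j * ((1 + ln b) * (real j + 1))"
    using b by (intro mult_left_mono) (auto simp: algebra_simps)
  finally show ?thesis by (simp add: mult_ac)
qed

text \<open>
  The factor by which \<open>b\<^sup>n\<close> may exceed \<open>b\<^sup>j\<close> is linear in \<open>j\<close>, hence costs only logarithmically
  many digits.
\<close>

lemma eventually_short_repeats_e:
  assumes b: "b \<ge> 2" and \<epsilon>: "\<epsilon> > 0"
  shows "\<forall>\<^sub>F n in sequentially. short_repeats (digits b (exp 1)) (2 * n) (nat \<lfloor>\<epsilon> * real n\<rfloor>)"
proof -
  define K where "K = 120 * (1 + ln (real b))"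
  have K: "K > 0" using b by (simp add: K_def add_pos_nonneg)
  have "\<forall>\<^sub>F n in sequentially. log 2 (K * (2 * real n + 1)) \<le> \<epsilon> * real n"
    using K \<epsilon> by real_asymp
  thus ?thesis
  proof eventually_elim
    case (elim n)
    show ?case unfolding short_repeats_def
    proof (intro allI impI)
      fix i j N assume r: "repeats (digits b (exp 1)) i j N" and j: "j \<le> 2 * n"
      show "N \<le> j + nat \<lfloor>\<epsilon> * real n\<rfloor>"
      proof (cases "N \<le> j")
        case False
        have "real b ^ j * real b ^ (N - j) = real b ^ N"
          using False by (simp flip: power_add)
        also have "\<dots> \<le> K * (real j + 1) * real b ^ j"
          using repeats_digits_e[OF b r] by (simp add: K_def)
        finally have "real b ^ (N - j) \<le> K * (real j + 1)" using b by (simp add: mult.commute)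
        also have "\<dots> \<le> K * (2 * real n + 1)" using K j by (intro mult_left_mono) auto
        finally have "2 ^ (N - j) \<le> K * (2 * real n + 1)"
          using power_mono[of 2 "real b" "N - j"] b by simp
        hence "log 2 (2 ^ (N - j)) \<le> log 2 (K * (2 * real n + 1))" by (intro log_mono) auto
        hence "real (N - j) \<le> \<epsilon> * real n" using elim by (simp add: log_nat_power)
        thus ?thesis by linarith
      qed simp
    qed
  qed
qed

lemma aperiodic_digits_e:
  assumes b: "b \<ge> 2"
  shows "aperiodic_word (digits b (exp 1))"
proof
  have "range (digits b (exp 1)) \<subseteq> {0..b - 1}"
    using is_expansion_digits[OF b] by (auto simp: is_expansion_def)
  thus "finite (range (digits b (exp 1)))" by (rule finite_subset) simp
  fix i j :: nat assume "i < j"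
  obtain n where n: "120 * (1 + ln b) * (real j + 1) * real b ^ j < real b ^ n"
    using real_arch_pow[of "real b"] b by auto
  thus "\<exists>n. \<not> repeats (digits b (exp 1)) i j n"
    using repeats_digits_e[OF b, of i j n] by (intro exI[of _ n]) linarith
qed

section \<open>Complexity of the digits of e\<close>

lemma complexity_eq_card_blocks: "complexity n \<xi> b = card (blocks (digits b \<xi>) n)"
  by (simp add: complexity_def blocks_def full_SetCompr_eq)

context aperiodic_word begin

lemma eventually_complexity_gt:
  assumes short: "\<And>\<epsilon>. \<epsilon> > 0 \<Longrightarrow> \<forall>\<^sub>F n in sequentially. short_repeats a (2 * n) (nat \<lfloor>\<epsilon> * real n\<rfloor>)"
    and c: "c < 9 / 8"
  shows "\<forall>\<^sub>F n in sequentially. c * real n < card (blocks a n)"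
proof -
  \<comment> \<open>Half of the gap absorbs the slack \<open>\<tau>\<close>, the other half the additive constant.\<close>
  define \<epsilon> where "\<epsilon> = (9 / 8 - c) / 2"
  have \<epsilon>: "\<epsilon> > 0" using c by (simp add: \<epsilon>_def)
  have "\<forall>\<^sub>F n in sequentially. 1 < \<epsilon> * real n" using \<epsilon> by real_asymp
  with short[OF \<epsilon>] show ?thesis
  proof eventually_elim
    case (elim n)
    define \<tau> where "\<tau> = nat \<lfloor>\<epsilon> * real n\<rfloor>"
    define f where "f = card (blocks a n) - n"
    have p: "card (blocks a n) = n + f" using card_blocks_ge[of n] by (simp add: f_def)
    have \<tau>: "real \<tau> \<le> \<epsilon> * real n" using elim by (simp add: \<tau>_def)
    have ce: "c * real n = 9 / 8 * real n - 2 * (\<epsilon> * real n)" by (simp add: \<epsilon>_def field_simps)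
    show ?case
    proof (cases "f \<le> n")
      case True
      have "n \<le> 8 * (f + \<tau> + 1)"
        by (rule excess_lower_bound) (use elim p True in \<open>auto simp: \<tau>_def\<close>)
      hence "real n \<le> real (8 * (f + \<tau> + 1))" by (simp only: of_nat_le_iff)
      thus ?thesis using \<tau> elim ce p by simp
    next
      case False
      thus ?thesis using ce p elim by simp
    qed
  qed
qed

lemma frequently_complexity_gt:
  assumes short: "\<And>\<epsilon>. \<epsilon> > 0 \<Longrightarrow> \<forall>\<^sub>F n in sequentially. short_repeats a (2 * n) (nat \<lfloor>\<epsilon> * real n\<rfloor>)"
    and c: "c < 8 / 7"
  shows "\<exists>\<^sub>F n in sequentially. c * real n < card (blocks a n)"
  unfolding frequently_def
proof
  assume "\<forall>\<^sub>F n in sequentially. \<not> c * real n < card (blocks a n)"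
  then obtain n0 where n0: "card (blocks a m) \<le> c * real m" if "m \<ge> n0" for m
    by (auto simp: eventually_sequentially not_less)
  \<comment> \<open>The bound by 1/8 keeps \<open>f + \<tau> + 1\<close> below \<open>n / 2\<close>, so that \<open>m \<ge> n / 2\<close> below.\<close>
  define \<epsilon> where "\<epsilon> = min (8 / 7 - c) 1 / 8"
  have \<epsilon>: "\<epsilon> > 0" "\<epsilon> \<le> 1 / 8" "8 * \<epsilon> \<le> 8 / 7 - c" using c by (auto simp: \<epsilon>_def)
  have "\<forall>\<^sub>F n in sequentially. real n * \<epsilon> > 2" using \<epsilon> by real_asymp
  moreover have "\<forall>\<^sub>F n in sequentially. real n > 4 * real n0 + 100" by real_asymp
  ultimately have "\<forall>\<^sub>F n in sequentially. False"
    using short[OF \<epsilon>(1)]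
  proof eventually_elim
    case (elim n)
    define \<tau> where "\<tau> = nat \<lfloor>\<epsilon> * real n\<rfloor>"
    define f where "f = card (blocks a n) - n"
    have p: "card (blocks a n) = n + f" using card_blocks_ge[of n] by (simp add: f_def)
    have \<tau>: "real \<tau> \<le> \<epsilon> * real n" using \<epsilon> by (simp add: \<tau>_def)
    have "\<epsilon> * real n \<le> real n / 8" using mult_right_mono[OF \<epsilon>(2), of "real n"] by simp
    hence \<tau>': "real \<tau> \<le> real n / 8" using \<tau> by linarith
    have "c * real n \<le> 8 / 7 * real n" using c by (intro mult_right_mono) auto
    moreover have "real (n + f) \<le> c * real n" using n0[of n] elim p by simp
    ultimately have f: "real f \<le> real n / 7" by simp
    have "n > f + \<tau> + 1" using f \<tau>' elim by linarith
    moreover have "short_repeats a (2 * n) \<tau>" using elim by (simp add: \<tau>_def)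
    moreover have "card (blocks a n) \<le> n + f" "f \<le> n" using p f by simp_all
    ultimately obtain m where m: "m \<le> n" "n \<le> m + (f + \<tau> + 1)"
      "8 * m \<le> 7 * (card (blocks a m) + \<tau> + 2)"
      using excess_lower_bound_nearby[of n \<tau> f] by blast
    have nm: "real n \<le> 2 * real m" using m f \<tau>' elim by linarith
    have "8 * real m \<le> 7 * (card (blocks a m) + \<tau> + 2)" using m(3) by linarith
    also have "\<dots> \<le> 7 * (c * real m + \<epsilon> * real n + 2)"
      using n0[of m] nm elim \<tau> by simp
    also have "\<dots> < 7 * (c * real m + 2 * (\<epsilon> * real n))" using elim by (simp add: mult.commute)
    also have "\<dots> \<le> 7 * (c * real m + 4 * (\<epsilon> * real m))"
      using mult_left_mono[OF nm, of \<epsilon>] \<epsilon> by simp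
    also have "\<dots> = 7 * ((c + 4 * \<epsilon>) * real m)" by (simp add: algebra_simps)
    also have "\<dots> \<le> 7 * (8 / 7 * real m)"
      using \<epsilon> by (intro mult_left_mono mult_right_mono) auto
    finally show ?case by simp
  qed
  thus False by simp
qed

end

theorem theorem1p5:
  fixes b :: nat
  assumes "b \<ge> 2"
  shows "liminf (\<lambda>n. ereal (real (complexity n (exp 1) b) / real n)) \<ge> ereal (9 / 8) \<and>
         limsup (\<lambda>n. ereal (real (complexity n (exp 1) b) / real n)) \<ge> ereal (8 / 7)"
proof
  interpret aperiodic_word "digits b (exp 1)" by (rule aperiodic_digits_e[OF assms])
  note short = eventually_short_repeats_e[OF assms]
  show "liminf (\<lambda>n. ereal (real (complexity n (exp 1) b) / real n)) \<ge> ereal (9 / 8)"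
    unfolding le_Liminf_iff
  proof (intro allI impI)
    fix y assume "y < ereal (9 / 8)"
    from ereal_dense2[OF this] obtain c where c: "y < ereal c" "ereal c < ereal (9 / 8)" by blast
    hence "\<forall>\<^sub>F n in sequentially. c * real n < complexity n (exp 1) b"
      using eventually_complexity_gt[OF short, of c] by (simp add: complexity_eq_card_blocks)
    with eventually_gt_at_top[of "0 :: nat"]
    show "\<forall>\<^sub>F n in sequentially. y < ereal (real (complexity n (exp 1) b) / real n)"
    proof eventually_elim
      case (elim n)
      hence "ereal c < ereal (real (complexity n (exp 1) b) / real n)" by (simp add: field_simps)
      with c(1) show ?case by (rule less_trans)
    qed
  qed
  show "limsup (\<lambda>n. ereal (real (complexity n (exp 1) b) / real n)) \<ge> ereal (8 / 7)"
  proof (rule ccontr)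
    assume "\<not> ?thesis"
    hence "limsup (\<lambda>n. ereal (real (complexity n (exp 1) b) / real n)) < ereal (8 / 7)"
      by (simp only: not_le)
    from ereal_dense2[OF this] obtain c where c: "limsup (\<lambda>n. ereal (real (complexity n (exp 1) b) / real n)) < ereal c"
        "ereal c < ereal (8 / 7)"
      by blast
    from Limsup_lessD[OF c(1)] eventually_gt_at_top[of "0 :: nat"]
    have "\<forall>\<^sub>F n in sequentially. \<not> c * real n < complexity n (exp 1) b"
      by eventually_elim (simp add: field_simps)
    thus False
      using frequently_complexity_gt[OF short, of c] c(2)
      by (simp add: frequently_def complexity_eq_card_blocks)
  qed
qed

end
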